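(* Fix a class index $c$ and a query index $l$. Let $\bm{s}_{1,c},\dots,\bm{s}_{n,c}$ ($n\ge 1$) be support samples, $\bm{q}_l$ a query sample, $f_\theta$ a map from samples to a feature space, and $\phi_\omega$ a map from the feature space to a real Hilbert space $\mathcal{H}$ with kernel $k(x,y)=\langle \phi_\omega(x),\phi_\omega(y)\rangle$. Let $h$ be a shrinkage (filter) function, $\lambda_{l,c}>0$ a shrinkage coefficient, and let $$\bm{\mu}_{l,c}(\lambda_{l,c})=\bm{\mu}_{l,c}-\sum_{i=1}^{n}h(\gamma_{i,c},\lambda_{l,c})\,\gamma_{i,c}\,\langle\bm{\mu}_{l,c},\bm{w}_{i,c}\rangle\,\bm{w}_{i,c}$$ be the kernel shrinkage estimation of the relative-prototype $\bm{\mu}_{l,c}$, where $\bm{\mu}_{l,c}$, $\bm{r}_{i,c}$ and $(\gamma_{i,c},\bm{w}_{i,c})$ are as defined in the context. Let $\bm{K}_{ss}^{c}$ be the $n\times n$ matrix with $(i,j)$ entry $k(f_\theta(\bm{s}_{i,c}),f_\theta(\bm{s}_{j,c}))$, and let $\bm{K}_{qs}^{l,c}$ be the $n\times n$ matrix with $(i,j)$ entry $k(f_\theta(\bm{s}_{i,c}),f_\theta(\bm{q}_{l}))$ for all $i,j$. Let $\bm{I}_n=[1/n,\dots,1/n]^T\in\mathbb{R}^n$, let $\bm{\hat I}_n$ be the $n\times n$ matrix all of whose entries equal $1/n$, and put $$\bm{\tilde K}_{ss}^{c}=\bm{K}_{ss}^{c}-\bm{\hat I}_n\bm{K}_{ss}^{c}-\bm{K}_{ss}^{c}\bm{\hat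 I}_n+\bm{\hat I}_n\bm{K}_{ss}^{c}\bm{\hat I}_n,$$ $$\bm{\tilde K}_{qs}^{l,c}=\bm{K}_{qs}^{l,c}-\bm{\hat I}_n\bm{K}_{qs}^{l,c}-\bm{K}_{ss}^{c}+\bm{\hat I}_n\bm{K}_{ss}^{c}.$$ Let $\bm{\tilde K}_{ss}^{c}=\bm{V}\bm{\Psi}\bm{V}^T$ be an eigen-decomposition, with $\bm V$ orthogonal and $\bm\Psi=\mathrm{diag}(\psi_1,\dots,\psi_n)$ the diagonal matrix of eigenvalues of $\bm{\tilde K}_{ss}^{c}$, and define $$g(\bm{\tilde K}_{ss}^{c},\lambda_{l,c})=\bm{V}\,\mathrm{diag}\big(h(\psi_1,\lambda_{l,c}),\dots,h(\psi_n,\lambda_{l,c})\big)\,\bm{V}^T .$$ Then $$\bm{\mu}_{l,c}(\lambda_{l,c})=\bm{\mu}_{l,c}-\sum_{i=1}^{n}\alpha_{l,i,c}(\lambda_{l,c})\,\bm{r}_{i,c},$$ where the coefficient vector $\bm{\alpha}_{l,c}(\lambda_{l,c})=[\alpha_{l,1,c}(\lambda_{l,c}),\dots,\alpha_{l,n,c}(\lambda_{l,c})]^T$ is $$\bm{\alpha}_{l,c}(\lambda_{l,c})=g(\bm{\tilde K}_{ss}^{c},\lambda_{l,c})\,\bm{\tilde K}_{qs}^{l,c}\,\bm{I}_n .$$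
   Context: Prototype of class $c$: $\bm{\mu}_c=\frac1n\sum_{i=1}^n\phi_\omega(f_\theta(\bm{s}_{i,c}))\in\mathcal H$. Relative-prototype: $\bm{\mu}_{l,c}=\phi_\omega(f_\theta(\bm{q}_l))-\bm{\mu}_c$. Centered support features: $\bm{r}_{i,c}=\phi_\omega(f_\theta(\bm{s}_{i,c}))-\bm{\mu}_c$ for $i=1,\dots,n$. Empirical covariance operator (no normalization factor): $\mathcal{C}=\sum_{i=1}^n\bm{r}_{i,c}\otimes\bm{r}_{i,c}$ on $\mathcal H$, where $(\bm u\otimes\bm u)\bm x=\langle\bm u,\bm x\rangle\bm u$. The pairs $(\gamma_{i,c},\bm{w}_{i,c})$, $i=1,\dots,n$, are eigenvalues and corresponding orthonormal eigenvectors of $\mathcal C$, listed with multiplicity in non-increasing order of eigenvalue; since $\mathcal C$ has rank at most $n$, all its nonzero eigenvalues are included. If $\dim\mathcal H<n$, the list is padded with $\gamma_{i,c}=0$ and $\bm{w}_{i,c}=0$. Shrinkage (filter) function: a real-valued function $h(\gamma,\lambda)$, defined for $\gamma\ge 0$ and $\lambda>0$, such that for each $\gamma>0$, $h(\gamma,\lambda)\to 1/\gamma$ as $\lambda$ decreases to $0$, and the amount of shrinkage $h(\gamma,\lambda)\gamma$ decreases or stays the same as $\lambda$ increases. Example (Tikhonov regularization): $h(\gamma,\lambda)=1/(\gamma+\lambda)$. *)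

theory Defs
  imports "HOL-Analysis.Analysis"
begin

text \<open>
  Samples have type \<open>'x\<close>, features type \<open>'y\<close>, and the Hilbert space is a type \<open>'h\<close> of class
  \<open>{real_inner, complete_space}\<close>, of finite or infinite dimension. The support samples of the
  fixed class form a family \<open>s :: 'n \<Rightarrow> 'x\<close> over a finite index type, so that
  \<open>n = CARD('n) \<ge> 1\<close>; the eigenpairs of the covariance operator are numbered \<open>1, \<dots>, n\<close>
  because they are listed in non-increasing order.
\<close>

subsection \<open>Prototypes\<close>

definition feature_kernel :: "('y \<Rightarrow> 'h::real_inner) \<Rightarrow> 'y \<Rightarrow> 'y \<Rightarrow> real" where
  "feature_kernel \<phi> x y = inner (\<phi> x) (\<phi> y)"

definition prototype :: "('x \<Rightarrow> 'y) \<Rightarrow> ('y \<Rightarrow> 'h::real_inner) \<Rightarrow> ('n::finite \<Rightarrow> 'x) \<Rightarrow> 'h" where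
  "prototype f \<phi> s = (1 / real CARD('n)) *\<^sub>R (\<Sum>i\<in>UNIV. \<phi> (f (s i)))"

definition relative_prototype ::
  "('x \<Rightarrow> 'y) \<Rightarrow> ('y \<Rightarrow> 'h::real_inner) \<Rightarrow> ('n::finite \<Rightarrow> 'x) \<Rightarrow> 'x \<Rightarrow> 'h" where
  "relative_prototype f \<phi> s q = \<phi> (f q) - prototype f \<phi> s"

definition centered_feature ::
  "('x \<Rightarrow> 'y) \<Rightarrow> ('y \<Rightarrow> 'h::real_inner) \<Rightarrow> ('n::finite \<Rightarrow> 'x) \<Rightarrow> 'n \<Rightarrow> 'h" where
  "centered_feature f \<phi> s i = \<phi> (f (s i)) - prototype f \<phi> s"

subsection \<open>The empirical covariance operator and its leading eigenpairs\<close>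

definition tensor_square :: "'h::real_inner \<Rightarrow> 'h \<Rightarrow> 'h" where
  "tensor_square u x = inner u x *\<^sub>R u"

definition covariance_op ::
  "('x \<Rightarrow> 'y) \<Rightarrow> ('y \<Rightarrow> 'h::real_inner) \<Rightarrow> ('n::finite \<Rightarrow> 'x) \<Rightarrow> 'h \<Rightarrow> 'h" where
  "covariance_op f \<phi> s x = (\<Sum>i\<in>UNIV. tensor_square (centered_feature f \<phi> s i) x)"

text \<open>
  The minimum of \<open>n\<close> and the dimension of the whole space. The case distinction is needed
  because \<open>dim\<close> is \<open>0\<close> on infinite-dimensional spaces.
\<close>

definition num_proper_pairs :: "'h::real_vector itself \<Rightarrow> nat \<Rightarrow> nat" where
  "num_proper_pairs _ n =
     (if \<exists>B :: 'h set. finite B \<and> span B = UNIV then min n (dim (UNIV :: 'h set)) else n)"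

text \<open>
  \<open>(\<gamma> i, w i)\<close>, for \<open>i = 1, \<dots>, n\<close>, is a non-increasing list of eigenvalues of \<open>C\<close> with
  orthonormal eigenvectors, padded by zeros if the space has dimension less than \<open>n\<close>. The last
  conjunct is the multiplicity condition: each nonzero \<open>c\<close> occurs in the list exactly as often
  as the dimension of \<open>{x. C x = c *\<^sub>R x}\<close> says (so not at all if \<open>c\<close> is not an eigenvalue).
  For an operator of rank at most \<open>n\<close> these dimensions are finite. The eigenvalue \<open>0\<close> only fills
  the remaining places, so no such count is imposed on it.
\<close>

definition eigenpair_listing ::
  "nat \<Rightarrow> ('h::real_inner \<Rightarrow> 'h) \<Rightarrow> (nat \<Rightarrow> real) \<Rightarrow> (nat \<Rightarrow> 'h) \<Rightarrow> bool" where
  "eigenpair_listing n C \<gamma> w \<longleftrightarrow>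
     (let d = num_proper_pairs TYPE('h) n in
       (\<forall>i\<in>{1..d}. C (w i) = \<gamma> i *\<^sub>R w i) \<and>
       (\<forall>i\<in>{1..d}. \<forall>j\<in>{1..d}. inner (w i) (w j) = (if i = j then 1 else 0)) \<and>
       (\<forall>i\<in>{d<..n}. \<gamma> i = 0 \<and> w i = 0) \<and>
       antimono_on {1..n} \<gamma> \<and>
       (\<forall>c. c \<noteq> 0 \<longrightarrow> card {i\<in>{1..n}. \<gamma> i = c} = dim {x. C x = c *\<^sub>R x}))"

subsection \<open>Shrinkage\<close>

text \<open>
  Shrinkage functions are meant for \<open>\<gamma> \<ge> 0\<close> and \<open>lam > 0\<close>; nothing is required of \<open>h\<close> elsewhere.
  At \<open>\<gamma> = 0\<close> the amount of shrinkage \<open>h \<gamma> lam * \<gamma>\<close> is constantly \<open>0\<close>.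
\<close>

definition shrinkage_function :: "(real \<Rightarrow> real \<Rightarrow> real) \<Rightarrow> bool" where
  "shrinkage_function h \<longleftrightarrow>
     (\<forall>\<gamma>>0. ((\<lambda>lam. h \<gamma> lam) \<longlongrightarrow> 1 / \<gamma>) (at_right 0) \<and>
            antimono_on {0<..} (\<lambda>lam. h \<gamma> lam * \<gamma>))"

definition kernel_shrinkage_estimate ::
  "(real \<Rightarrow> real \<Rightarrow> real) \<Rightarrow> nat \<Rightarrow> (nat \<Rightarrow> real) \<Rightarrow> (nat \<Rightarrow> 'h::real_inner) \<Rightarrow> 'h \<Rightarrow> real \<Rightarrow> 'h" where
  "kernel_shrinkage_estimate h n \<gamma> w \<mu> lam =
     \<mu> - (\<Sum>i=1..n. (h (\<gamma> i) lam * \<gamma> i * inner \<mu> (w i)) *\<^sub>R w i)"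

subsection \<open>Kernel matrices\<close>

definition K_ss ::
  "('x \<Rightarrow> 'y) \<Rightarrow> ('y \<Rightarrow> 'h::real_inner) \<Rightarrow> ('n::finite \<Rightarrow> 'x) \<Rightarrow> real^'n^'n" where
  "K_ss f \<phi> s = (\<chi> i j. feature_kernel \<phi> (f (s i)) (f (s j)))"

definition K_qs ::
  "('x \<Rightarrow> 'y) \<Rightarrow> ('y \<Rightarrow> 'h::real_inner) \<Rightarrow> ('n::finite \<Rightarrow> 'x) \<Rightarrow> 'x \<Rightarrow> real^'n^'n" where
  "K_qs f \<phi> s q = (\<chi> i j. feature_kernel \<phi> (f (s i)) (f q))"

definition avg_vec :: "real^'n" where
  "avg_vec = (\<chi> i. 1 / real CARD('n))"

definition avg_mat :: "real^'n^'n" where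
  "avg_mat = (\<chi> i j. 1 / real CARD('n))"

definition centered_K_ss ::
  "('x \<Rightarrow> 'y) \<Rightarrow> ('y \<Rightarrow> 'h::real_inner) \<Rightarrow> ('n::finite \<Rightarrow> 'x) \<Rightarrow> real^'n^'n" where
  "centered_K_ss f \<phi> s =
     K_ss f \<phi> s - avg_mat ** K_ss f \<phi> s - K_ss f \<phi> s ** avg_mat
       + avg_mat ** K_ss f \<phi> s ** avg_mat"

definition centered_K_qs ::
  "('x \<Rightarrow> 'y) \<Rightarrow> ('y \<Rightarrow> 'h::real_inner) \<Rightarrow> ('n::finite \<Rightarrow> 'x) \<Rightarrow> 'x \<Rightarrow> real^'n^'n" where
  "centered_K_qs f \<phi> s q =
     K_qs f \<phi> s q - avg_mat ** K_qs f \<phi> s q - K_ss f \<phi> s + avg_mat ** K_ss f \<phi> s"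

definition diag_mat :: "real^'n \<Rightarrow> real^'n^'n" where
  "diag_mat a = (\<chi> i j. if i = j then a $ i else 0)"

definition eigen_decomposition :: "real^'n^'n \<Rightarrow> real^'n^'n \<Rightarrow> real^'n \<Rightarrow> bool" where
  "eigen_decomposition A V \<psi> \<longleftrightarrow>
     orthogonal_matrix V \<and> A = V ** diag_mat \<psi> ** transpose V"

text \<open>
  The matrix obtained by applying \<open>h\<close> to the eigenvalues of the matrix with eigen-decomposition
  given by \<open>V\<close> and \<open>\<psi>\<close>.
\<close>

definition spectral_filter ::
  "(real \<Rightarrow> real \<Rightarrow> real) \<Rightarrow> real^'n^'n \<Rightarrow> real^'n \<Rightarrow> real \<Rightarrow> real^'n^'n" where
  "spectral_filter h V \<psi> lam = V ** diag_mat (\<chi> i. h (\<psi> $ i) lam) ** transpose V"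

end

theory Submission
  imports Defs
begin

text \<open>
  Let \<open>u k = (\<Sum>i. V\<^sub>i\<^sub>k r\<^sub>i)\<close>. The centred kernel matrix is the Gram matrix of the \<open>r\<^sub>i\<close>, so the
  \<open>u k\<close> are orthogonal with \<open>\<parallel>u k\<parallel>\<^sup>2 = \<psi>\<^sub>k\<close>; since \<open>V\<close> is orthogonal, the covariance operator is
  \<open>C x = (\<Sum>k. \<langle>u k, x\<rangle> u k)\<close>, and \<open>(\<Sum>i. \<alpha>\<^sub>i r\<^sub>i) = (\<Sum>k. h(\<psi>\<^sub>k) \<langle>u k, \<mu>\<rangle> u k)\<close>.
  Expanding \<open>\<gamma>\<^sub>i w\<^sub>i = C w\<^sub>i\<close> in the \<open>u k\<close>, where only terms with \<open>\<psi>\<^sub>k = \<gamma>\<^sub>i\<close> occur, and each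
  \<open>u k\<close> in the \<open>w\<^sub>i\<close>, which by the multiplicity condition span the eigenspaces of \<open>C\<close> for its
  nonzero eigenvalues, identifies this with the spectral sum of the shrinkage estimate.
\<close>

section \<open>Eigenpair listings of finite-rank operators\<close>

text \<open>A vector of \<open>E\<close> outside \<open>span W\<close> would extend \<open>W\<close>
  to an independent set larger than a basis of \<open>E\<close>. The finite \<open>U\<close> makes
  that basis finite, so that \<open>dim E\<close> is a genuine dimension.\<close>

lemma independent_card_eq_dim_spans:
  fixes W E U :: "'a::real_vector set"
  assumes "independent W" "finite W" "W \<subseteq> E" "card W = dim E" "finite U" "E \<subseteq> span U"
  shows "E \<subseteq> span W"
proof
  fix x assume x: "x \<in> E"
  obtain B where B: "B \<subseteq> E" "independent B" "E \<subseteq> span B" "card B = dim E"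
    using basis_exists by blast
  have "B \<subseteq> span U" using B assms by blast
  then have finB: "finite B" using independent_span_bound[OF assms(5) B(2)] by blast
  show "x \<in> span W"
  proof (rule ccontr)
    assume nx: "x \<notin> span W"
    then have ind: "independent (insert x W)"
      using assms(1) independent_insertI by blast
    have "x \<notin> W" using nx span_base by blast
    moreover have "insert x W \<subseteq> span B" using x B assms by blast
    then have "card (insert x W) \<le> card B" using independent_span_bound[OF finB ind] by blast
    ultimately show False using assms B by simp
  qed
qed

text \<open>Both sides are linear in \<open>x\<close>, and for a generator \<open>w j\<close> only
  the term \<open>i = j\<close> survives.\<close>

lemma orthonormal_expansion:
  fixes w :: "'i \<Rightarrow> 'a::real_inner"
  assumes "finite I" "\<And>i j. i \<in> I \<Longrightarrow> j \<in> I \<Longrightarrow> inner (w i) (w j) = (if i = j then 1 else 0)"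
    and "x \<in> span (w ` I)"
  shows "x = (\<Sum>i\<in>I. inner x (w i) *\<^sub>R w i)"
  using assms(3)
proof (induction rule: span_induct_alt)
  case base
  then show ?case by simp
next
  case (step c y z)
  then obtain j where j: "j \<in> I" "y = w j" by blast
  have "(\<Sum>i\<in>I. inner y (w i) *\<^sub>R w i) = (\<Sum>i\<in>I. if j = i then w i else 0)"
    by (rule sum.cong) (use assms(2) j in auto)
  also have "\<dots> = y" using assms(1) j by simp
  finally have "y = (\<Sum>i\<in>I. inner y (w i) *\<^sub>R w i)" ..
  then have cy: "c *\<^sub>R y = (\<Sum>i\<in>I. (c * inner y (w i)) *\<^sub>R w i)"
    by (metis (no_types, lifting) scaleR_scaleR scaleR_sum_right sum.cong)
  have "(\<Sum>i\<in>I. inner (c *\<^sub>R y + z) (w i) *\<^sub>R w i)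
      = (\<Sum>i\<in>I. (c * inner y (w i)) *\<^sub>R w i) + (\<Sum>i\<in>I. inner z (w i) *\<^sub>R w i)"
    by (simp add: inner_add_left scaleR_add_left sum.distrib)
  then show ?case
    by (simp only: cy[symmetric] step.IH[symmetric])
qed

lemma orthonormal_independent:
  fixes w :: "'i \<Rightarrow> 'a::real_inner"
  assumes "\<And>i j. i \<in> I \<Longrightarrow> j \<in> I \<Longrightarrow> inner (w i) (w j) = (if i = j then 1 else 0)"
  shows "independent (w ` I)" and "inj_on w I"
proof -
  have "w i \<noteq> 0" if "i \<in> I" for i
    using assms[OF that that] by auto
  then have "0 \<notin> w ` I" by fastforce
  moreover have "pairwise orthogonal (w ` I)"
    unfolding pairwise_image pairwise_def orthogonal_def using assms by auto
  ultimately show "independent (w ` I)" by (rule pairwise_orthogonal_independent[rotated])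
  show "inj_on w I" by (rule inj_onI) (metis assms zero_neq_one)
qed

lemma num_proper_pairs_le: "num_proper_pairs TYPE('h::real_vector) n \<le> n"
  by (simp add: num_proper_pairs_def)

text \<open>Hides the case distinction on the dimension of the space behind a number
  \<open>d \<le> n\<close>.\<close>

lemma eigenpair_listingD:
  fixes w :: "nat \<Rightarrow> 'h::real_inner"
  assumes "eigenpair_listing n C \<gamma> w"
  obtains d where "d \<le> n"
    "\<And>i. i \<in> {1..d} \<Longrightarrow> C (w i) = \<gamma> i *\<^sub>R w i"
    "\<And>i j. i \<in> {1..d} \<Longrightarrow> j \<in> {1..d} \<Longrightarrow> inner (w i) (w j) = (if i = j then 1 else 0)"
    "\<And>i. i \<in> {d<..n} \<Longrightarrow> \<gamma> i = 0" "\<And>i. i \<in> {d<..n} \<Longrightarrow> w i = 0"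
    "\<And>c. c \<noteq> 0 \<Longrightarrow> card {i\<in>{1..n}. \<gamma> i = c} = dim {x. C x = c *\<^sub>R x}"
  by (rule that[OF num_proper_pairs_le[where 'h='h]])
    (use assms in \<open>simp_all add: eigenpair_listing_def Let_def\<close>)

text \<open>Both sides are \<open>F(C)\<close> applied to \<open>C \<mu>\<close>. The right side has
  no factor \<open>\<psi> k\<close> because \<open>u k\<close> is not normalized: its squared norm
  is \<open>\<psi> k\<close>.\<close>

lemma eigenpair_listing_filter_sum:
  fixes u :: "'k \<Rightarrow> 'h::real_inner" and C :: "'h \<Rightarrow> 'h"
  assumes fin: "finite K"
    and orth: "\<And>k l. k \<in> K \<Longrightarrow> l \<in> K \<Longrightarrow> inner (u k) (u l) = (if k = l then \<psi> k else 0)"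
    and C: "\<And>x. C x = (\<Sum>k\<in>K. inner (u k) x *\<^sub>R u k)"
    and listing: "eigenpair_listing n C \<gamma> w"
  shows "(\<Sum>i=1..n. (F (\<gamma> i) * \<gamma> i * inner \<mu> (w i)) *\<^sub>R w i)
       = (\<Sum>k\<in>K. (F (\<psi> k) * inner (u k) \<mu>) *\<^sub>R u k)"
proof -
  obtain d where d: "d \<le> n"
    and eig: "\<And>i. i \<in> {1..d} \<Longrightarrow> C (w i) = \<gamma> i *\<^sub>R w i"
    and on: "\<And>i j. i \<in> {1..d} \<Longrightarrow> j \<in> {1..d} \<Longrightarrow> inner (w i) (w j) = (if i = j then 1 else 0)"
    and pad0: "\<And>i. i \<in> {d<..n} \<Longrightarrow> \<gamma> i = 0" and pad: "\<And>i. i \<in> {d<..n} \<Longrightarrow> w i = 0"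
    and mult: "\<And>c. c \<noteq> 0 \<Longrightarrow> card {i\<in>{1..n}. \<gamma> i = c} = dim {x. C x = c *\<^sub>R x}"
    using eigenpair_listingD[OF listing] by blast
  have uC: "inner (u k) (C x) = \<psi> k * inner (u k) x" if "k \<in> K" for k x
  proof -
    have "inner (u k) (C x) = (\<Sum>l\<in>K. if k = l then \<psi> k * inner (u k) x else 0)"
      unfolding C inner_sum_right by (rule sum.cong) (use orth that in auto)
    then show ?thesis using fin that by simp
  qed
  have Cu: "C (u k) = \<psi> k *\<^sub>R u k" if "k \<in> K" for k
  proof -
    have "C (u k) = (\<Sum>l\<in>K. if k = l then \<psi> k *\<^sub>R u k else 0)"
      unfolding C by (rule sum.cong) (use orth that in auto)
    then show ?thesis using fin that by simp
  qed
  \<comment> \<open>The eigenvalue equation extends to the padding, where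
    \<open>w i = 0\<close>.\<close>
  have eig': "C (w i) = \<gamma> i *\<^sub>R w i" if "i \<in> {1..n}" for i
    using that eig[of i] pad[of i] by (cases "i \<le> d") (auto simp: C)
  \<comment> \<open>Pairing \<open>C (w i)\<close> with \<open>u k\<close> gives both
    \<open>\<psi> k\<close> and \<open>\<gamma> i\<close> times \<open>inner (u k) (w i)\<close>,
    which cancels.\<close>
  have match: "\<psi> k = \<gamma> i" if "i \<in> {1..n}" "k \<in> K" "inner (u k) (w i) \<noteq> 0" for i k
    using uC[OF that(2), of "w i"] eig'[OF that(1)] that(3) by simp
  have u_exp: "(\<Sum>i=1..n. inner (u k) (w i) *\<^sub>R w i) = u k" if k: "k \<in> K" for k
  proof (cases "\<psi> k = 0")
    case True
    then have "u k = 0" using orth[OF k k] by simp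
    then show ?thesis by simp
  next
    case False
    define I where "I = {i\<in>{1..n}. \<gamma> i = \<psi> k}"
    define E where "E = {x. C x = \<psi> k *\<^sub>R x}"
    \<comment> \<open>Since \<open>\<psi> k\<close> is nonzero, \<open>I\<close> avoids the padding,
      so the \<open>w i\<close> with \<open>i \<in> I\<close> are orthonormal.\<close>
    have "i \<in> {1..d}" if "i \<in> I" for i
      using that False pad0[of i] by (cases "i \<le> d") (auto simp: I_def)
    then have onI: "inner (w i) (w j) = (if i = j then 1 else 0)" if "i \<in> I" "j \<in> I" for i j
      using on that by blast
    have finI: "finite I" by (simp add: I_def)
    \<comment> \<open>An eigenspace for a nonzero eigenvalue lies in the range of \<open>C\<close>,
      which the finitely many \<open>u k\<close> span.\<close>
    have "E \<subseteq> span (u ` K)"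
    proof
      fix x assume "x \<in> E"
      then have "x = (1 / \<psi> k) *\<^sub>R C x" using False by (simp add: E_def)
      also have "\<dots> \<in> span (u ` K)"
        unfolding C by (intro span_scale span_sum span_base imageI)
      finally show "x \<in> span (u ` K)" .
    qed
    moreover have "w ` I \<subseteq> E" using eig' by (auto simp: I_def E_def)
    moreover have "card (w ` I) = dim E"
      using mult[OF False] card_image[OF orthonormal_independent(2)[of I w]] onI
      by (simp add: I_def E_def)
    ultimately have "E \<subseteq> span (w ` I)"
      using independent_card_eq_dim_spans[of "w ` I" E "u ` K"]
        orthonormal_independent(1)[of I w] onI finI fin by blast
    then have "u k \<in> span (w ` I)" using Cu[OF k] by (auto simp: E_def)
    then have "u k = (\<Sum>i\<in>I. inner (u k) (w i) *\<^sub>R w i)"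
      using orthonormal_expansion[of I w] onI finI by blast
    also have "\<dots> = (\<Sum>i=1..n. inner (u k) (w i) *\<^sub>R w i)"
    \<comment> \<open>Outside \<open>I\<close> the eigenvalues differ, so \<open>match\<close>
      forces the coefficients to vanish.\<close>
    proof (rule sum.mono_neutral_left)
      show "\<forall>i\<in>{1..n} - I. inner (u k) (w i) *\<^sub>R w i = 0"
        using match[OF _ k] by (fastforce simp: I_def)
    qed (auto simp: I_def)
    finally show ?thesis ..
  qed
  have coeff: "F (\<gamma> i) * \<gamma> i * inner \<mu> (w i)
      = (\<Sum>k\<in>K. F (\<psi> k) * inner (u k) \<mu> * inner (u k) (w i))" if i: "i \<in> {1..n}" for i
  proof -
    have "\<gamma> i * inner \<mu> (w i) = inner \<mu> (C (w i))" using eig'[OF i] by simp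
    also have "\<dots> = (\<Sum>k\<in>K. inner (u k) (w i) * inner (u k) \<mu>)"
      by (simp add: C inner_sum_right inner_commute[of \<mu>])
    finally have "F (\<gamma> i) * \<gamma> i * inner \<mu> (w i)
        = (\<Sum>k\<in>K. F (\<gamma> i) * (inner (u k) (w i) * inner (u k) \<mu>))"
      by (simp add: mult.assoc sum_distrib_left)
    \<comment> \<open>In each term either the inner product with \<open>w i\<close> is zero or
      \<open>\<gamma> i = \<psi> k\<close>.\<close>
    also have "\<dots> = (\<Sum>k\<in>K. F (\<psi> k) * inner (u k) \<mu> * inner (u k) (w i))"
      by (rule sum.cong) (use match[OF i] in fastforce)+
    finally show ?thesis .
  qed
  have "(\<Sum>i=1..n. (F (\<gamma> i) * \<gamma> i * inner \<mu> (w i)) *\<^sub>R w i)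
      = (\<Sum>i=1..n. \<Sum>k\<in>K. (F (\<psi> k) * inner (u k) \<mu>) *\<^sub>R (inner (u k) (w i) *\<^sub>R w i))"
    by (rule sum.cong) (simp_all only: coeff scaleR_sum_left scaleR_scaleR)
  also have "\<dots> = (\<Sum>k\<in>K. (F (\<psi> k) * inner (u k) \<mu>) *\<^sub>R u k)"
    by (subst sum.swap) (simp only: scaleR_sum_right[symmetric] u_exp cong: sum.cong)
  finally show ?thesis .
qed

section \<open>Centred kernel matrices as inner products\<close>

lemma avg_mat_mult_nth:
  "(avg_mat ** A) $ i $ j = (\<Sum>k\<in>UNIV. A $ k $ j) / real CARD('n)"
  for A :: "real^'m^'n::finite"
  by (simp add: avg_mat_def matrix_matrix_mult_def sum_divide_distrib)

lemma mult_avg_mat_nth: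
  "(A ** avg_mat) $ i $ j = (\<Sum>k\<in>UNIV. A $ i $ k) / real CARD('n)"
  for A :: "real^'n::finite^'m"
  by (simp add: avg_mat_def matrix_matrix_mult_def sum_divide_distrib)

lemma inner_prototype_left:
  fixes s :: "'n::finite \<Rightarrow> 'x"
  shows "inner (prototype f \<phi> s) x = (\<Sum>k\<in>UNIV. inner (\<phi> (f (s k))) x) / real CARD('n)"
  by (simp add: prototype_def inner_sum_left)

lemma inner_prototype_right:
  fixes s :: "'n::finite \<Rightarrow> 'x"
  shows "inner x (prototype f \<phi> s) = (\<Sum>k\<in>UNIV. inner x (\<phi> (f (s k)))) / real CARD('n)"
  by (simp add: prototype_def inner_sum_right)

text \<open>Expanding the inner product of two deviations from the mean yields exactly the double
  centring: column and row means are subtracted, the grand mean is added.\<close>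

lemma centered_K_ss_nth:
  fixes s :: "'n::finite \<Rightarrow> 'x"
  shows "centered_K_ss f \<phi> s $ i $ j = inner (centered_feature f \<phi> s i) (centered_feature f \<phi> s j)"
  by (simp add: centered_K_ss_def avg_mat_mult_nth mult_avg_mat_nth K_ss_def feature_kernel_def
      centered_feature_def inner_diff_left inner_diff_right inner_prototype_left
      inner_prototype_right sum_subtractf diff_divide_distrib flip: sum_divide_distrib)

text \<open>Left multiplication by \<open>avg_mat\<close> centres only the row index, so the sample
  \<open>s j\<close> itself remains on the right.\<close>

lemma centered_K_qs_nth:
  fixes s :: "'n::finite \<Rightarrow> 'x"
  shows "centered_K_qs f \<phi> s q $ i $ j = inner (centered_feature f \<phi> s i) (\<phi> (f q) - \<phi> (f (s j)))"
  by (simp add: centered_K_qs_def avg_mat_mult_nth K_ss_def K_qs_def feature_kernel_def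
      centered_feature_def inner_diff_left inner_diff_right inner_prototype_left)

text \<open>Averaging over the column index replaces \<phi>(f(s j)) by the prototype.\<close>

lemma centered_K_qs_mult_avg_vec:
  fixes s :: "'n::finite \<Rightarrow> 'x"
  shows "centered_K_qs f \<phi> s q *v avg_vec
       = (\<chi> i. inner (centered_feature f \<phi> s i) (relative_prototype f \<phi> s q))"
  by (simp add: vec_eq_iff matrix_vector_mult_def avg_vec_def centered_K_qs_nth
      relative_prototype_def inner_diff_right inner_prototype_right sum_subtractf
      diff_divide_distrib flip: sum_divide_distrib)

section \<open>Rotation by the eigenvector matrix\<close>

lemma orthogonal_matrix_sum:
  fixes V :: "real^'n^'n"
  assumes "orthogonal_matrix V"
  shows "(\<Sum>k\<in>UNIV. V $ i $ k * V $ j $ k) = (if i = j then 1 else 0)"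
proof -
  have "(V ** transpose V) $ i $ j = (mat 1 :: real^'n^'n) $ i $ j"
    using assms by (simp add: orthogonal_matrix_def)
  then show ?thesis by (simp add: matrix_matrix_mult_def transpose_def mat_def)
qed

text \<open>Read from the inside: coordinates of \<open>b\<close> along the columns of
  \<open>V\<close>, scaling by \<open>a\<close>, recombination.\<close>

lemma conj_diag_mat_mult_vec:
  fixes V :: "real^'n^'n"
  shows "(V ** diag_mat a ** transpose V) *v b
       = (\<chi> i. \<Sum>k\<in>UNIV. V $ i $ k * (a $ k * (\<Sum>j\<in>UNIV. V $ j $ k * b $ j)))"
proof -
  have "diag_mat a *v y = (\<chi> k. a $ k * y $ k)" for y
    by (simp add: vec_eq_iff matrix_vector_mult_def diag_mat_def if_distrib[of "\<lambda>t. t * _"]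
        cong: if_cong)
  then show ?thesis
    by (simp only: matrix_vector_mul_assoc[symmetric])
      (simp add: matrix_vector_mult_def transpose_def del: transpose_matrix_vector)
qed

text \<open>This is \<open>transpose V ** A ** V = diag_mat \<psi>\<close> entrywise; for a Gram
  matrix \<open>A\<close> it says that the rotated vectors are orthogonal.\<close>

lemma transpose_conj_eigen_decomposition:
  assumes "eigen_decomposition A V \<psi>"
  shows "(\<Sum>i\<in>UNIV. \<Sum>j\<in>UNIV. V $ i $ k * V $ j $ l * A $ i $ j) = (if k = l then \<psi> $ k else 0)"
proof -
  have V: "transpose V ** V = mat 1" and A: "A = V ** diag_mat \<psi> ** transpose V"
    using assms by (auto simp: eigen_decomposition_def orthogonal_matrix)
  have "transpose V ** A ** V = (transpose V ** V) ** diag_mat \<psi> ** (transpose V ** V)"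
    by (simp only: A matrix_mul_assoc)
  then have "(transpose V ** (A ** V)) $ k $ l = diag_mat \<psi> $ k $ l"
    by (simp add: V matrix_mul_assoc)
  then show ?thesis
    by (simp add: matrix_matrix_mult_def transpose_def diag_mat_def sum_distrib_left mult_ac)
qed

theorem theorem1:
  fixes f :: "'x \<Rightarrow> 'y"
    and \<phi> :: "'y \<Rightarrow> 'h::{real_inner, complete_space}"
    and s :: "'n::finite \<Rightarrow> 'x"
    and q :: 'x
    and h :: "real \<Rightarrow> real \<Rightarrow> real"
    and lam :: real
    and \<gamma> :: "nat \<Rightarrow> real"
    and w :: "nat \<Rightarrow> 'h"
    and V :: "real^'n^'n"
    and \<psi> :: "real^'n"
    and \<alpha> :: "real^'n"
  assumes "shrinkage_function h"
    and "lam > 0"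
    and "eigenpair_listing CARD('n) (covariance_op f \<phi> s) \<gamma> w"
    and "eigen_decomposition (centered_K_ss f \<phi> s) V \<psi>"
    and "\<alpha> = (spectral_filter h V \<psi> lam ** centered_K_qs f \<phi> s q) *v avg_vec"
  shows "kernel_shrinkage_estimate h CARD('n) \<gamma> w (relative_prototype f \<phi> s q) lam =
           relative_prototype f \<phi> s q - (\<Sum>i\<in>UNIV. (\<alpha> $ i) *\<^sub>R centered_feature f \<phi> s i)"
proof -
  define r where "r = centered_feature f \<phi> s"
  define \<mu> where "\<mu> = relative_prototype f \<phi> s q"
  define u where "u k = (\<Sum>i\<in>UNIV. V $ i $ k *\<^sub>R r i)" for k
  have orthV: "orthogonal_matrix V" using assms(4) by (simp add: eigen_decomposition_def)
  have inner_u: "inner (u k) x = (\<Sum>j\<in>UNIV. V $ j $ k * inner (r j) x)" for k x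
    by (simp add: u_def inner_sum_left)
  have orth: "inner (u k) (u l) = (if k = l then \<psi> $ k else 0)" for k l
  proof -
    have "inner (u k) (u l)
        = (\<Sum>i\<in>UNIV. \<Sum>j\<in>UNIV. V $ i $ k * V $ j $ l * centered_K_ss f \<phi> s $ i $ j)"
      unfolding u_def inner_sum_left
      by (simp add: centered_K_ss_nth inner_sum_right sum_distrib_left mult_ac flip: r_def)
    then show ?thesis using transpose_conj_eigen_decomposition[OF assms(4)] by simp
  qed
  \<comment> \<open>Rotation preserves the sum of tensor squares: with the sum over \<open>k\<close>
    moved innermost, orthonormality of the rows of \<open>V\<close> leaves only
    \<open>i = j\<close>.\<close>
  have cov: "covariance_op f \<phi> s x = (\<Sum>k\<in>UNIV. inner (u k) x *\<^sub>R u k)" for x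
  proof -
    have "(\<Sum>k\<in>UNIV. inner (u k) x *\<^sub>R u k)
        = (\<Sum>k\<in>UNIV. \<Sum>i\<in>UNIV. \<Sum>j\<in>UNIV. (V $ i $ k * V $ j $ k * inner (r j) x) *\<^sub>R r i)"
      by (simp only: inner_u)
        (simp add: u_def scaleR_sum_left scaleR_sum_right sum_distrib_left mult_ac)
    also have "\<dots> = (\<Sum>i\<in>UNIV. \<Sum>k\<in>UNIV. \<Sum>j\<in>UNIV. (V $ i $ k * V $ j $ k * inner (r j) x) *\<^sub>R r i)"
      by (rule sum.swap)
    also have "\<dots> = (\<Sum>i\<in>UNIV. \<Sum>j\<in>UNIV. \<Sum>k\<in>UNIV. (V $ i $ k * V $ j $ k * inner (r j) x) *\<^sub>R r i)"
      by (intro sum.cong refl sum.swap)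
    also have "\<dots> = (\<Sum>i\<in>UNIV. \<Sum>j\<in>UNIV. if i = j then inner (r j) x *\<^sub>R r i else 0)"
      by (intro sum.cong refl)
        (simp add: orthogonal_matrix_sum[OF orthV] flip: scaleR_sum_left sum_distrib_right)
    also have "\<dots> = covariance_op f \<phi> s x"
      by (simp add: covariance_op_def tensor_square_def r_def)
    finally show ?thesis ..
  qed
  \<comment> \<open>Applying \<open>transpose V\<close> to the vector of inner products of the
    \<open>r j\<close> with \<open>\<mu>\<close> gives the vector of
    \<open>inner (u k) \<mu>\<close>.\<close>
  have \<alpha>: "\<alpha> $ i = (\<Sum>k\<in>UNIV. V $ i $ k * (h (\<psi> $ k) lam * inner (u k) \<mu>))" for i
  proof -
    have "\<alpha> = spectral_filter h V \<psi> lam *v (centered_K_qs f \<phi> s q *v avg_vec)"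
      by (simp only: assms(5) matrix_vector_mul_assoc)
    then show ?thesis
      by (simp only: spectral_filter_def centered_K_qs_mult_avg_vec conj_diag_mat_mult_vec)
        (simp add: inner_u r_def \<mu>_def)
  qed
  have "(\<Sum>i\<in>UNIV. (\<alpha> $ i) *\<^sub>R r i)
      = (\<Sum>i\<in>UNIV. \<Sum>k\<in>UNIV. (h (\<psi> $ k) lam * inner (u k) \<mu>) *\<^sub>R V $ i $ k *\<^sub>R r i)"
    by (simp add: \<alpha> scaleR_sum_left mult_ac)
  also have "\<dots> = (\<Sum>k\<in>UNIV. (h (\<psi> $ k) lam * inner (u k) \<mu>) *\<^sub>R u k)"
    by (subst sum.swap) (simp only: u_def scaleR_sum_right)
  \<comment> \<open>The filter \<open>h\<close> with \<open>lam\<close> fixed serves as the function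
    \<open>F\<close> of the eigenvalue.\<close>
  also have "\<dots> = (\<Sum>i=1..CARD('n). (h (\<gamma> i) lam * \<gamma> i * inner \<mu> (w i)) *\<^sub>R w i)"
    using eigenpair_listing_filter_sum[of UNIV u "($) \<psi>", OF _ _ cov assms(3),
        of "\<lambda>c. h c lam" \<mu>] orth by simp
  finally show ?thesis by (simp add: kernel_shrinkage_estimate_def r_def \<mu>_def)
qed

end
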